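(* Let $\Gamma$ be a (finitely generated, Gromov) hyperbolic group. If an action of $\Gamma$ by isometries on a metric space $X$ is such that the orbit maps are quasi-isometric embeddings, then this action is well displacing.
   Context: Fix a finite generating set $S$ of $\Gamma$, with word length $\Vert\cdot\Vert$ and word metric $d_S$. The translation length is $\ell(\gamma)=\inf_{\eta\in\Gamma}\Vert\eta\gamma\eta^{-1}\Vert$. For an isometry $\gamma$ of a metric space $X$, the displacement is $d_X(\gamma)=\inf_{x\in X}d(x,\gamma(x))$. An action of $\Gamma$ by isometries on $X$ is well displacing if there exist positive constants $A,B$ such that $d_X(\gamma)\geqslant A\,\ell(\gamma)-B$ for all $\gamma\in\Gamma$. Orbit maps are the maps $\Gamma\to X$, $\gamma\mapsto\gamma(x)$; such a map is a quasi-isometric embedding if there are $A\geqslant 1$, $B\geqslant 0$ with $A^{-1}d_S(\gamma,\eta)-B\leqslant d(\gamma(x),\eta(x))\leqslant A\,d_S(\gamma,\eta)+B$ for all $\gamma,\eta\in\Gamma$. *)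

theory Defs
  imports
    "HOL-Algebra.Group_Action"
    "HOL-Algebra.Generated_Groups"
    "HOL-Analysis.Analysis"
begin

section \<open>Word length and word metric\<close>

definition finite_generating_set :: "('a, 'm) monoid_scheme \<Rightarrow> 'a set \<Rightarrow> bool" where
  "finite_generating_set G S \<longleftrightarrow>
     finite S \<and> S \<subseteq> carrier G \<and> generate G S = carrier G"

text \<open>
  The set \<open>S\<close> need not be symmetric: words may use generators and their inverses.
  \<open>LEAST\<close> is meaningful for every group element as soon as \<open>S\<close> generates the group.
\<close>

definition word_length :: "('a, 'm) monoid_scheme \<Rightarrow> 'a set \<Rightarrow> 'a \<Rightarrow> nat" where
  "word_length G S g =
     (LEAST n. \<exists>w. length w = n \<and> set w \<subseteq> S \<union> (\<lambda>s. inv\<^bsub>G\<^esub> s) ` S \<and>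
                   foldr (\<otimes>\<^bsub>G\<^esub>) w \<one>\<^bsub>G\<^esub> = g)"

text \<open>
  The left-invariant word metric; with it, the orbit maps \<open>g \<mapsto> g(x)\<close> of an isometric
  (left) action are equivariant.
\<close>

definition word_metric :: "('a, 'm) monoid_scheme \<Rightarrow> 'a set \<Rightarrow> 'a \<Rightarrow> 'a \<Rightarrow> real" where
  "word_metric G S g h = real (word_length G S (inv\<^bsub>G\<^esub> g \<otimes>\<^bsub>G\<^esub> h))"

definition translation_length :: "('a, 'm) monoid_scheme \<Rightarrow> 'a set \<Rightarrow> 'a \<Rightarrow> real" where
  "translation_length G S g =
     (INF h\<in>carrier G. real (word_length G S (h \<otimes>\<^bsub>G\<^esub> g \<otimes>\<^bsub>G\<^esub> inv\<^bsub>G\<^esub> h)))"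


section \<open>Hyperbolic groups\<close>

definition gromov_product :: "('a \<Rightarrow> 'a \<Rightarrow> real) \<Rightarrow> 'a \<Rightarrow> 'a \<Rightarrow> 'a \<Rightarrow> real" where
  "gromov_product d w x y = (d x w + d y w - d x y) / 2"

definition gromov_hyperbolic :: "'a set \<Rightarrow> ('a \<Rightarrow> 'a \<Rightarrow> real) \<Rightarrow> bool" where
  "gromov_hyperbolic M d \<longleftrightarrow>
     (\<exists>\<delta>\<ge>0. \<forall>w\<in>M. \<forall>x\<in>M. \<forall>y\<in>M. \<forall>z\<in>M.
        gromov_product d w x z \<ge> min (gromov_product d w x y) (gromov_product d w y z) - \<delta>)"

text \<open>
  Hyperbolicity does not depend on the finite generating set; as usual, the definition
  asks for some finite generating set with hyperbolic word metric.
\<close>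

definition hyperbolic_group :: "('a, 'm) monoid_scheme \<Rightarrow> bool" where
  "hyperbolic_group G \<longleftrightarrow>
     group G \<and>
     (\<exists>S. finite_generating_set G S \<and> gromov_hyperbolic (carrier G) (word_metric G S))"


section \<open>Actions by isometries\<close>

text \<open>
  In the library locale \<^locale>\<open>group_action\<close>, the maps \<open>\<phi> g\<close> are bijections of \<open>X\<close>, taken to
  be \<open>undefined\<close> outside \<open>X\<close>; this only fixes their representation.
\<close>

locale isometric_action = group_action G X \<phi> + Metric_space X d
  for G (structure) and X :: "'b set" and d and \<phi> +
  assumes isometric:
    "\<lbrakk>g \<in> carrier G; x \<in> X; y \<in> X\<rbrakk> \<Longrightarrow> d (\<phi> g x) (\<phi> g y) = d x y"

text \<open>
  The infimum is taken in \<^typ>\<open>ereal\<close>, so that it is \<open>\<infinity>\<close> if \<open>X\<close> is empty; for nonempty \<open>X\<close>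
  it is the usual nonnegative real infimum.
\<close>

definition displacement :: "'b set \<Rightarrow> ('b \<Rightarrow> 'b \<Rightarrow> real) \<Rightarrow> ('b \<Rightarrow> 'b) \<Rightarrow> ereal" where
  "displacement X d f = (INF x\<in>X. ereal (d x (f x)))"

definition well_displacing ::
  "('a, 'm) monoid_scheme \<Rightarrow> 'a set \<Rightarrow> 'b set \<Rightarrow> ('b \<Rightarrow> 'b \<Rightarrow> real) \<Rightarrow> ('a \<Rightarrow> 'b \<Rightarrow> 'b) \<Rightarrow> bool" where
  "well_displacing G S X d \<phi> \<longleftrightarrow>
     (\<exists>A B :: real. A > 0 \<and> B > 0 \<and>
        (\<forall>g\<in>carrier G.
           displacement X d (\<phi> g) \<ge> ereal (A * translation_length G S g - B)))"

definition quasi_isometric_embedding ::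
  "'a set \<Rightarrow> ('a \<Rightarrow> 'a \<Rightarrow> real) \<Rightarrow> 'b set \<Rightarrow> ('b \<Rightarrow> 'b \<Rightarrow> real) \<Rightarrow> ('a \<Rightarrow> 'b) \<Rightarrow> bool" where
  "quasi_isometric_embedding M d N d' f \<longleftrightarrow>
     f \<in> M \<rightarrow> N \<and>
     (\<exists>A B :: real. A \<ge> 1 \<and> B \<ge> 0 \<and>
        (\<forall>x\<in>M. \<forall>y\<in>M. inverse A * d x y - B \<le> d' (f x) (f y) \<and> d' (f x) (f y) \<le> A * d x y + B))"

end

theory Submission
  imports Defs
begin

text \<open>
  Since \<open>d\<^sub>X(\<gamma>)\<close> is at least the growth rate of \<open>n \<mapsto> d(x, \<gamma>\<^sup>n x)\<close>, and orbit maps are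
  quasi-isometric embeddings, it suffices to bound the stable length \<open>lim \<parallel>\<gamma>\<^sup>n\<parallel> / n\<close> from below
  by \<open>\<ell>(\<gamma>) - C\<close>. Replace \<open>\<gamma>\<close> by a shortest conjugate \<open>g\<close>, of length \<open>L\<close>. If the Gromov product of
  \<open>1\<close> and \<open>g\<^sup>2\<close> at \<open>g\<close> were large, then cutting off the two nearly coinciding ends of a geodesic
  word for \<open>g\<close> would give a shorter conjugate. Hence the points \<open>g\<^sup>n\<close> form a local quasi-geodesic
  with steps of length \<open>L\<close>, and hyperbolicity makes it a global one: \<open>\<parallel>g\<^sup>n\<parallel> \<ge> n (L - C)\<close>. All word
  metrics are bi-Lipschitz equivalent, so it does not matter that hyperbolicity is only known
  for another generating set.
\<close>

section \<open>Word metrics\<close>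

locale finitely_generated_group = group G for G (structure) +
  fixes S
  assumes generating: "finite_generating_set G S"
begin

section \<open>Words in the generators and their inverses\<close>

abbreviation (input) letters where "letters \<equiv> S \<union> (\<lambda>s. inv s) ` S"

abbreviation (input) eval_word where "eval_word w \<equiv> foldr (\<otimes>) w \<one>"

lemma letters_carrier: "letters \<subseteq> carrier G"
  using generating by (auto simp: finite_generating_set_def)

lemma eval_word_closed [simp]: "set w \<subseteq> carrier G \<Longrightarrow> eval_word w \<in> carrier G"
  by (induction w) auto

lemma eval_word_append:
  "\<lbrakk>set u \<subseteq> carrier G; set v \<subseteq> carrier G\<rbrakk> \<Longrightarrow> eval_word (u @ v) = eval_word u \<otimes> eval_word v"
  by (induction u) (auto simp: m_assoc)

lemma eval_word_rev_inv:
  "set w \<subseteq> carrier G \<Longrightarrow> eval_word (rev (map (\<lambda>s. inv s) w)) = inv (eval_word w)"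
proof (induction w)
  case (Cons s w)
  have "eval_word (rev (map (\<lambda>s. inv s) (s # w)))
      = eval_word (rev (map (\<lambda>s. inv s) w)) \<otimes> eval_word [inv s]"
    unfolding list.map rev.simps using Cons.prems by (intro eval_word_append) auto
  then show ?case
    using Cons by (simp add: inv_mult_group)
qed simp

lemma word_length_le: "set w \<subseteq> letters \<Longrightarrow> word_length G S (eval_word w) \<le> length w"
  unfolding word_length_def by (rule Least_le) blast

lemma ex_word: 
  assumes "g \<in> carrier G"
  shows "\<exists>w. set w \<subseteq> letters \<and> eval_word w = g"
proof -
  have "g \<in> generate G S"
    using assms generating by (simp add: finite_generating_set_def)
  then show ?thesis
  proof induction
    case one
    show ?case by (rule exI[of _ "[]"]) simp
  next
    case (incl h)
    then show ?case using letters_carrier by (intro exI[of _ "[h]"]) auto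
  next
    case (inv h)
    then show ?case using letters_carrier by (intro exI[of _ "[inv h]"]) auto
  next
    case (eng h1 h2)
    then obtain u v where uv: "set u \<subseteq> letters" "eval_word u = h1"
      "set v \<subseteq> letters" "eval_word v = h2"
      by blast
    then have "eval_word (u @ v) = h1 \<otimes> h2"
      using letters_carrier eval_word_append[of u v] by blast
    with uv show ?case by (intro exI[of _ "u @ v"]) auto
  qed
qed

lemma shortest_word:
  assumes "g \<in> carrier G"
  obtains w where "set w \<subseteq> letters" "eval_word w = g" "length w = word_length G S g"
proof -
  have "\<exists>n w. length w = n \<and> set w \<subseteq> letters \<and> eval_word w = g"
    using ex_word[OF assms] by blast
  from LeastI_ex[OF this] that show ?thesis
    unfolding word_length_def by blast
qed

lemma word_length_one [simp]: "word_length G S \<one> = 0"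
  using word_length_le[of "[]"] by simp

lemma word_length_mult:
  assumes "g \<in> carrier G" "h \<in> carrier G"
  shows "word_length G S (g \<otimes> h) \<le> word_length G S g + word_length G S h"
proof -
  obtain u where u: "set u \<subseteq> letters" "eval_word u = g" "length u = word_length G S g"
    using shortest_word assms by metis
  obtain v where v: "set v \<subseteq> letters" "eval_word v = h" "length v = word_length G S h"
    using shortest_word assms by metis
  have "eval_word (u @ v) = g \<otimes> h"
    using u v letters_carrier eval_word_append[of u v] by blast
  with word_length_le[of "u @ v"] u v show ?thesis by simp
qed

lemma word_length_inv_le:
  assumes "g \<in> carrier G"
  shows "word_length G S (inv g) \<le> word_length G S g"
proof -
  obtain u where u: "set u \<subseteq> letters" "eval_word u = g" "length u = word_length G S g"
    using shortest_word assms by metis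
  have "set (rev (map (\<lambda>s. inv s) u)) \<subseteq> letters"
    using u(1) generating by (fastforce simp: finite_generating_set_def)
  from word_length_le[OF this] show ?thesis
    using u letters_carrier eval_word_rev_inv[of u] by auto
qed

lemma word_length_inv: "g \<in> carrier G \<Longrightarrow> word_length G S (inv g) = word_length G S g"
  using word_length_inv_le[of g] word_length_inv_le[of "inv g"] by simp

text \<open>Meant for words over a different generating set: each letter of \<open>w\<close> is
  respelled with at most \<open>K\<close> elements of \<open>letters\<close>.\<close>

lemma word_length_eval_word_le:
  assumes "set w \<subseteq> carrier G" "\<And>s. s \<in> set w \<Longrightarrow> word_length G S s \<le> K"
  shows "word_length G S (eval_word w) \<le> K * length w"
  using assms
proof (induction w)
  case (Cons s w)
  then have "word_length G S (eval_word (s # w)) \<le> word_length G S s + word_length G S (eval_word w)"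
    by (simp add: word_length_mult)
  also have "\<dots> \<le> K + K * length w"
    using Cons by (intro add_mono) auto
  finally show ?case by simp
qed simp

section \<open>The left-invariant word metric and its geodesics\<close>

lemma word_metric_nonneg: "0 \<le> word_metric G S g h"
  by (simp add: word_metric_def)

lemma word_metric_one_left: "g \<in> carrier G \<Longrightarrow> word_metric G S \<one> g = word_length G S g"
  by (simp add: word_metric_def)

lemma word_metric_commute:
  assumes "g \<in> carrier G" "h \<in> carrier G"
  shows "word_metric G S g h = word_metric G S h g"
proof -
  have "inv h \<otimes> g = inv (inv g \<otimes> h)"
    using assms by (simp add: inv_mult_group)
  then show ?thesis
    using assms by (simp add: word_metric_def word_length_inv)
qed

lemma mult_inv_cancel_left:
  "\<lbrakk>g \<in> carrier G; h \<in> carrier G\<rbrakk> \<Longrightarrow> g \<otimes> (inv g \<otimes> h) = h"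
  "\<lbrakk>g \<in> carrier G; h \<in> carrier G\<rbrakk> \<Longrightarrow> inv g \<otimes> (g \<otimes> h) = h"
  by (simp_all add: m_assoc[symmetric])

lemma word_metric_triangle:
  assumes "g \<in> carrier G" "h \<in> carrier G" "k \<in> carrier G"
  shows "word_metric G S g k \<le> word_metric G S g h + word_metric G S h k"
proof -
  have "inv g \<otimes> k = (inv g \<otimes> h) \<otimes> (inv h \<otimes> k)"
    using assms by (simp add: m_assoc mult_inv_cancel_left)
  then show ?thesis
    using assms word_length_mult[of "inv g \<otimes> h" "inv h \<otimes> k"] by (simp add: word_metric_def)
qed

lemma word_metric_mult_left:
  assumes "g \<in> carrier G" "h \<in> carrier G" "k \<in> carrier G"
  shows "word_metric G S (k \<otimes> g) (k \<otimes> h) = word_metric G S g h"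
proof -
  have "inv (k \<otimes> g) \<otimes> (k \<otimes> h) = inv g \<otimes> h"
    using assms by (simp add: inv_mult_group m_assoc mult_inv_cancel_left)
  then show ?thesis by (simp add: word_metric_def)
qed

text \<open>The points are the values of the prefixes of a shortest word; beyond the end of the word
  \<open>take\<close> makes \<open>p\<close> constant.\<close>

lemma word_geodesic:
  assumes "g \<in> carrier G"
  obtains p :: "nat \<Rightarrow> 'a" where "p 0 = \<one>" "p (word_length G S g) = g" "range p \<subseteq> carrier G"
    "\<And>i j. i \<le> j \<Longrightarrow> j \<le> word_length G S g \<Longrightarrow> word_metric G S (p i) (p j) = real (j - i)"
proof -
  let ?L = "word_length G S g"
  obtain w where w: "set w \<subseteq> letters" "eval_word w = g" "length w = ?L"
    using shortest_word assms by metis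
  define p where "p i = eval_word (take i w)" for i
  have wc: "set w \<subseteq> carrier G" using w letters_carrier by blast
  have tc: "set (take i w) \<subseteq> carrier G" for i
    using wc set_take_subset by fastforce
  have pc: "p i \<in> carrier G" for i
    using tc by (simp add: p_def)
  have p0: "p 0 = \<one>" and pL: "p ?L = g"
    using w by (simp_all add: p_def)
  have le: "word_metric G S (p i) (p j) \<le> real (j - i)" if "i \<le> j" "j \<le> ?L" for i j
  proof -
    let ?v = "take (j - i) (drop i w)"
    have v: "set ?v \<subseteq> set w" by (meson set_take_subset set_drop_subset subset_trans)
    have "take j w = take i w @ ?v"
      using that by (metis take_add le_add_diff_inverse)
    then have "p j = p i \<otimes> eval_word ?v"
      using eval_word_append[OF tc[of i], of ?v] v wc by (simp add: p_def)
    moreover have "eval_word ?v \<in> carrier G"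
      using v wc by simp
    ultimately have "inv (p i) \<otimes> p j = eval_word ?v"
      using pc by (simp add: inv_solve_left' m_assoc[symmetric])
    moreover have "word_length G S (eval_word ?v) \<le> length ?v"
      using v w by (intro word_length_le) blast
    ultimately show ?thesis by (simp add: word_metric_def)
  qed
  \<comment> \<open>Cutting the path at \<open>i\<close> and \<open>j\<close> gives three pieces,
    each bounded above by \<open>le\<close>. The bounds add up to the distance of the end points, so
    none of them is strict.\<close>
  have "word_metric G S (p i) (p j) = real (j - i)" if "i \<le> j" "j \<le> ?L" for i j
  proof -
    have "real ?L = word_metric G S (p 0) (p ?L)"
      using assms by (simp add: p0 pL word_metric_one_left)
    also have "\<dots> \<le> word_metric G S (p 0) (p i) + word_metric G S (p i) (p j)
        + word_metric G S (p j) (p ?L)"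
      using word_metric_triangle[OF pc[of 0] pc[of i] pc[of ?L]]
        word_metric_triangle[OF pc[of i] pc[of j] pc[of ?L]] by linarith
    finally show ?thesis
      using le[of 0 i] le[of i j] le[of j ?L] that by (simp add: of_nat_diff)
  qed
  with p0 pL pc that show ?thesis by blast
qed

lemma translation_length_le:
  assumes "h \<in> carrier G"
  shows "translation_length G S g \<le> word_length G S (h \<otimes> g \<otimes> inv h)"
  unfolding translation_length_def using assms
  by (intro cINF_lower bdd_belowI2[of _ 0]) auto

end

lemma word_length_Lipschitz:
  assumes "finitely_generated_group G S" "finitely_generated_group G T"
  obtains K :: nat where "K > 0"
    "\<And>g. g \<in> carrier G \<Longrightarrow> word_length G S g \<le> K * word_length G T g"
proof -
  interpret S: finitely_generated_group G S by fact
  interpret T: finitely_generated_group G T by fact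
  let ?A = "T \<union> (\<lambda>s. inv\<^bsub>G\<^esub> s) ` T"
  \<comment> \<open>\<open>Suc\<close> keeps \<open>K\<close> positive even if every letter is
    trivial. For empty \<open>T\<close> the value of \<open>Max\<close> is unspecified, but then
    there is no letter to bound.\<close>
  define K where "K = Suc (Max (word_length G S ` ?A))"
  have "finite ?A"
    using T.generating by (simp add: finite_generating_set_def)
  then have K: "word_length G S s \<le> K" if "s \<in> ?A" for s
    unfolding K_def using that by (intro le_SucI Max_ge) auto
  have "word_length G S g \<le> K * word_length G T g" if g: "g \<in> carrier G" for g
  proof -
    obtain w where "set w \<subseteq> ?A" "foldr (\<otimes>\<^bsub>G\<^esub>) w \<one>\<^bsub>G\<^esub> = g" "length w = word_length G T g"
      using T.shortest_word g by metis
    then show ?thesis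
      using S.word_length_eval_word_le[of w K] K T.letters_carrier by auto
  qed
  then show ?thesis
    using that[of K] by (simp add: K_def)
qed

section \<open>Stable length in hyperbolic groups\<close>

text \<open>A local-to-global principle: seen from any vertex, the Gromov product of the starting
  point and the next vertex exceeds the local bound \<open>c\<close> by at most
  \<open>\<delta>\<close>, so each step gains at least
  \<open>L - 2 * (c + \<delta>)\<close>.\<close>

lemma gromov_product_chain_length:
  fixes x :: "nat \<Rightarrow> 'a" and d :: "'a \<Rightarrow> 'a \<Rightarrow> real"
  assumes hyp: "\<And>u v w z. \<lbrakk>u \<in> M; v \<in> M; w \<in> M; z \<in> M\<rbrakk> \<Longrightarrow>
      gromov_product d u v z \<ge> min (gromov_product d u v w) (gromov_product d u w z) - \<delta>"
    and nonneg: "\<And>u v. \<lbrakk>u \<in> M; v \<in> M\<rbrakk> \<Longrightarrow> 0 \<le> d u v"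
    and commute: "\<And>u v. \<lbrakk>u \<in> M; v \<in> M\<rbrakk> \<Longrightarrow> d u v = d v u"
    and x: "\<And>n. x n \<in> M"
    and step: "\<And>n. d (x n) (x (Suc n)) = L"
    and turn: "\<And>n. gromov_product d (x (Suc n)) (x n) (x (Suc (Suc n))) \<le> c"
    and "0 \<le> \<delta>" "0 \<le> c" "2 * (c + \<delta>) < L"
  shows "real n * (L - 2 * (c + \<delta>)) \<le> d (x 0) (x n)"
proof -
  have start: "gromov_product d (x (Suc n)) (x 0) (x (Suc (Suc n))) \<le> c + \<delta>" for n
  proof (induction n)
    case 0
    then show ?case using turn[of 0] \<open>0 \<le> \<delta>\<close> by simp
  next
    case (Suc n)
    let ?u = "x (Suc n)" and ?v = "x (Suc (Suc n))" and ?w = "x (Suc (Suc (Suc n)))"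
    \<comment> \<open>The two products, based at the ends of one side, add up to its length
      \<open>L\<close>. As \<open>L\<close> is more than twice \<open>c + \<delta>\<close>, the
      induction hypothesis makes this one exceed \<open>c + \<delta>\<close>, so the minimum in the
      hyperbolic inequality must be the other product.\<close>
    have "gromov_product d ?v ?u (x 0) = L - gromov_product d ?u (x 0) ?v"
      using step[of "Suc n"] commute[OF x x, of "Suc n" 0]
        commute[OF x x, of "Suc n" "Suc (Suc n)"]
      by (simp add: gromov_product_def field_simps)
    with Suc have "gromov_product d ?v ?u (x 0) > c + \<delta>"
      using \<open>2 * (c + \<delta>) < L\<close> by simp
    moreover have "min (gromov_product d ?v ?u (x 0)) (gromov_product d ?v (x 0) ?w) - \<delta> \<le> c"
      using hyp[OF x x x x] turn[of "Suc n"] by (rule order_trans)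
    ultimately show ?case by linarith
  qed
  show ?thesis
  proof (induction n)
    case 0
    then show ?case using nonneg x by simp
  next
    case (Suc n)
    show ?case
    \<comment> \<open>The first step has no vertex to turn at: \<open>start\<close> only covers base
      points \<open>x (Suc m)\<close>.\<close>
    proof (cases n)
      case 0
      then show ?thesis using step[of 0] \<open>0 \<le> \<delta>\<close> \<open>0 \<le> c\<close> by simp
    next
      case (Suc m)
      have "d (x 0) (x (Suc n)) \<ge> d (x 0) (x n) + L - 2 * (c + \<delta>)"
        using start[of m] step[of n] commute[OF x x, of n "Suc n"] Suc
        by (simp add: gromov_product_def field_simps)
      with Suc.IH show ?thesis by (simp add: algebra_simps)
    qed
  qed
qed

section \<open>Shortest conjugates and their powers\<close>

context finitely_generated_group
begin

text \<open>Conjugating by an initial piece \<open>z\<close> of a geodesic to \<open>g\<close>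
  rotates its word cyclically. If the geodesics from \<open>g\<close> back to \<open>\<one>\<close>
  and on to \<open>g \<otimes> g\<close> stayed close for long, the rotated word would admit a
  shortcut. The summands \<open>1\<close> pay for rounding to integers.\<close>

lemma shortest_conjugate_gromov_product:
  assumes hyp: "\<And>u v w z.
      \<lbrakk>u \<in> carrier G; v \<in> carrier G; w \<in> carrier G; z \<in> carrier G\<rbrakk> \<Longrightarrow>
      gromov_product (word_metric G S) u v z \<ge>
        min (gromov_product (word_metric G S) u v w) (gromov_product (word_metric G S) u w z) - \<delta>"
    and g: "g \<in> carrier G"
    and shortest: "\<And>h. h \<in> carrier G \<Longrightarrow>
      word_length G S g \<le> word_length G S (inv h \<otimes> g \<otimes> h)"
    and long: "real (word_length G S g) > 4 * \<delta> + 1"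
  shows "gromov_product (word_metric G S) g \<one> (g \<otimes> g) \<le> 2 * \<delta> + 1"
proof -
  let ?d = "word_metric G S"
  define L where "L = word_length G S g"
  define r where "r = gromov_product ?d g \<one> (g \<otimes> g)"
  obtain p where p: "p 0 = \<one>" "p L = g" "range p \<subseteq> carrier G"
    and geodesic: "\<And>i j. i \<le> j \<Longrightarrow> j \<le> L \<Longrightarrow> ?d (p i) (p j) = real (j - i)"
    using word_geodesic[OF g] unfolding L_def by metis
  have pc [simp]: "p i \<in> carrier G" for i using p by blast
  have "r \<ge> 0"
    using word_metric_triangle[of \<one> g "g \<otimes> g"] g word_metric_commute[of g "g \<otimes> g"]
    by (simp add: r_def gromov_product_def)
  \<comment> \<open>Both branches at \<open>g\<close> are followed for the integer part of
    \<open>r\<close>; the cap at half of \<open>L\<close> keeps \<open>z\<close> from lying beyond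
    \<open>y\<close> on the geodesic.\<close>
  define t where "t = min (nat \<lfloor>r\<rfloor>) (L div 2)"
  have tr: "real t \<le> r"
    using \<open>r \<ge> 0\<close> by (simp add: t_def min_def) linarith
  have tL: "2 * t \<le> L" by (simp add: t_def)
  define y z where "y = p (L - t)" and "z = p t"
  have yz [simp]: "y \<in> carrier G" "z \<in> carrier G" by (simp_all add: y_def z_def)
  have dy: "?d \<one> y = L - t" "?d y g = t" and dz: "?d \<one> z = t" "?d z g = L - t"
    and dzy: "?d z y = L - 2 * t" and dg: "?d \<one> g = L"
    using tL geodesic[of 0 "L - t"] geodesic[of "L - t" L] geodesic[of 0 t] geodesic[of t L]
      geodesic[of t "L - t"] geodesic[of 0 L] p
    by (auto simp: y_def z_def of_nat_diff)
  have dgz: "?d g (g \<otimes> z) = t" "?d (g \<otimes> z) (g \<otimes> g) = L - t" "?d g (g \<otimes> g) = L"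
    using word_metric_mult_left[of \<one> z g] word_metric_mult_left[of z g g]
      word_metric_mult_left[of \<one> g g] g dz dg by auto
  \<comment> \<open>The rotated word leads from \<open>z\<close> to \<open>g \<otimes> z\<close>.
    The route through \<open>y\<close> spends only \<open>L - 2 * t\<close> before \<open>y\<close>,
    so minimality forces the remaining gap to be at least \<open>2 * t\<close>.\<close>
  have "L \<le> word_length G S (inv z \<otimes> g \<otimes> z)"
    unfolding L_def by (rule shortest) simp
  then have "real L \<le> ?d z (g \<otimes> z)"
    using g by (simp add: word_metric_def m_assoc)
  also have "\<dots> \<le> ?d z y + ?d y (g \<otimes> z)"
    using g by (intro word_metric_triangle) auto
  finally have far: "?d y (g \<otimes> z) \<ge> 2 * real t"
    using dzy tL by (simp add: of_nat_diff)
  have sides: "gromov_product ?d g y \<one> = t" "gromov_product ?d g (g \<otimes> g) (g \<otimes> z) = t"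
    using dy dg dgz g tL word_metric_commute[of \<one> y] word_metric_commute[of g "g \<otimes> g"]
      word_metric_commute[of g "g \<otimes> z"] word_metric_commute[of "g \<otimes> z" "g \<otimes> g"]
    by (auto simp: gromov_product_def of_nat_diff)
  \<comment> \<open>Hyperbolicity is used twice along \<open>y\<close>, \<open>\<one>\<close>,
    \<open>g \<otimes> g\<close>, \<open>g \<otimes> z\<close>, whose consecutive products at
    \<open>g\<close> are \<open>t\<close>, \<open>r\<close> and \<open>t\<close> with
    \<open>t\<close> at most \<open>r\<close>. Each use costs one \<open>\<delta>\<close>.\<close>
  have "min (gromov_product ?d g y \<one>) (gromov_product ?d g \<one> (g \<otimes> z)) - \<delta>
      \<le> gromov_product ?d g y (g \<otimes> z)"
    and "min (gromov_product ?d g \<one> (g \<otimes> g)) (gromov_product ?d g (g \<otimes> g) (g \<otimes> z)) - \<delta>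
      \<le> gromov_product ?d g \<one> (g \<otimes> z)"
    using g by (auto intro!: hyp)
  then have "real t - 2 * \<delta> \<le> gromov_product ?d g y (g \<otimes> z) \<or>
      real t - \<delta> \<le> gromov_product ?d g y (g \<otimes> z)"
    using sides tr unfolding r_def by linarith
  moreover have "gromov_product ?d g y (g \<otimes> z) \<le> 0"
    using far dy dgz word_metric_commute[of g "g \<otimes> z"] g by (simp add: gromov_product_def)
  moreover have "\<delta> \<ge> 0"
    using hyp[OF g g g g] by simp
  ultimately have "real t \<le> 2 * \<delta>" by linarith
  \<comment> \<open>So the cap is not what makes \<open>t\<close> small, and the bound on
    \<open>t\<close> passes to the integer part of \<open>r\<close>.\<close>
  moreover have "real (L div 2) > 2 * \<delta>"
    using long unfolding L_def[symmetric] by linarith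
  ultimately have "real (nat \<lfloor>r\<rfloor>) \<le> 2 * \<delta>"
    by (auto simp: t_def min_def split: if_splits)
  then show ?thesis
    unfolding r_def[symmetric] by linarith
qed

text \<open>The constant is \<open>2 * (c + \<delta>)\<close> for the turning bound
  \<open>c = 2 * \<delta> + 1\<close>. It also exceeds the threshold
  \<open>4 * \<delta> + 1\<close>; for shorter \<open>g\<close> the left side is at most
  zero.\<close>

lemma shortest_conjugate_pow_length:
  assumes hyp: "\<And>u v w z.
      \<lbrakk>u \<in> carrier G; v \<in> carrier G; w \<in> carrier G; z \<in> carrier G\<rbrakk> \<Longrightarrow>
      gromov_product (word_metric G S) u v z \<ge>
        min (gromov_product (word_metric G S) u v w) (gromov_product (word_metric G S) u w z) - \<delta>"
    and g: "g \<in> carrier G"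
    and shortest: "\<And>h. h \<in> carrier G \<Longrightarrow>
      word_length G S g \<le> word_length G S (inv h \<otimes> g \<otimes> h)"
  shows "real n * (real (word_length G S g) - (6 * \<delta> + 2)) \<le> word_length G S (g [^] n)"
proof (cases "real (word_length G S g) > 6 * \<delta> + 2")
  case True
  have \<delta>: "\<delta> \<ge> 0"
    using hyp[OF g g g g] by simp
  have turn: "gromov_product (word_metric G S) g \<one> (g \<otimes> g) \<le> 2 * \<delta> + 1"
    using hyp g shortest True \<delta> by (intro shortest_conjugate_gromov_product) auto
  have pow: "g [^] Suc n = g [^] n \<otimes> g" "g [^] Suc (Suc n) = g [^] n \<otimes> (g \<otimes> g)" for n
    using g by (simp_all add: m_assoc)
  have "real n * (real (word_length G S g) - 2 * (2 * \<delta> + 1 + \<delta>))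
      \<le> word_metric G S (g [^] (0::nat)) (g [^] n)"
  proof (rule gromov_product_chain_length[where M = "carrier G" and x = "\<lambda>n::nat. g [^] n"])
    show "word_metric G S (g [^] n) (g [^] Suc n) = word_length G S g" for n :: nat
      using word_metric_mult_left[of \<one> g "g [^] n"] g
      by (simp add: word_metric_one_left)
    \<comment> \<open>Left translation by \<open>g [^] n\<close> carries \<open>\<one>\<close>,
      \<open>g\<close>, \<open>g \<otimes> g\<close> to these three powers.\<close>
    show "gromov_product (word_metric G S) (g [^] Suc n) (g [^] n) (g [^] Suc (Suc n))
        \<le> 2 * \<delta> + 1" for n :: nat
      using turn g word_metric_mult_left[of _ _ "g [^] n"] word_metric_mult_left[of \<one> _ "g [^] n"]
      unfolding pow(2) unfolding pow(1) by (simp add: gromov_product_def)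
  qed (use hyp g \<delta> True word_metric_nonneg word_metric_commute in auto)
  then show ?thesis
    using g by (simp add: word_metric_one_left)
next
  case False
  then have "real n * (real (word_length G S g) - (6 * \<delta> + 2)) \<le> 0"
    by (intro mult_nonneg_nonpos) auto
  then show ?thesis by (rule order_trans) simp
qed

text \<open>Lengths are natural numbers, so the minimum over the conjugacy class is attained;
  conjugates of a conjugate of \<open>g\<close> are again conjugates of \<open>g\<close>.\<close>

lemma ex_shortest_conjugate:
  assumes "g \<in> carrier G"
  obtains h where "h \<in> carrier G"
    "\<And>k. k \<in> carrier G \<Longrightarrow>
      word_length G S (h \<otimes> g \<otimes> inv h) \<le> word_length G S (inv k \<otimes> (h \<otimes> g \<otimes> inv h) \<otimes> k)"
proof -
  obtain h where h: "h \<in> carrier G" and least: "\<And>k. k \<in> carrier G \<Longrightarrow>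
      word_length G S (h \<otimes> g \<otimes> inv h) \<le> word_length G S (k \<otimes> g \<otimes> inv k)"
    using ex_has_least_nat[of "\<lambda>h. h \<in> carrier G" \<one> "\<lambda>h. word_length G S (h \<otimes> g \<otimes> inv h)"]
    by blast
  have "inv k \<otimes> (h \<otimes> g \<otimes> inv h) \<otimes> k = (inv k \<otimes> h) \<otimes> g \<otimes> inv (inv k \<otimes> h)"
    if "k \<in> carrier G" for k
    using that h assms by (simp add: inv_mult_group m_assoc)
  with h least that show ?thesis by (metis inv_closed m_closed)
qed

end

section \<open>Displacement\<close>

text \<open>After division by \<open>n\<close> the error \<open>D\<close> vanishes in the limit, so
  only growth rates are compared.\<close>

lemma le_if_nat_multiples_le_add:
  fixes a b D :: real
  assumes "\<And>n::nat. real n * a \<le> real n * b + D"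
  shows "a \<le> b"
proof (rule ccontr)
  assume "\<not> a \<le> b"
  then obtain n :: nat where "real n * (a - b) > D"
    using reals_Archimedean3[of "a - b"] by auto
  with assms[of n] show False by (simp add: algebra_simps)
qed

context isometric_action
begin

lemma action_mult:
  "\<lbrakk>g \<in> carrier G; h \<in> carrier G; x \<in> X\<rbrakk> \<Longrightarrow> \<phi> (g \<otimes> h) x = \<phi> g (\<phi> h x)"
  using composition_rule by blast

lemma action_closed: "\<lbrakk>g \<in> carrier G; x \<in> X\<rbrakk> \<Longrightarrow> \<phi> g x \<in> X"
  using element_image by blast

lemma action_one: "x \<in> X \<Longrightarrow> \<phi> \<one> x = x"
  by (metis id_eq_one restrict_apply)

lemma dist_action_pow_le:
  assumes "g \<in> carrier G" "y \<in> X"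
  shows "d y (\<phi> (g [^] n) y) \<le> real n * d y (\<phi> g y)"
proof (induction n)
  case 0
  then show ?case using assms action_one by simp
next
  case (Suc n)
  interpret group G using group_hom group_hom.axioms by blast
  let ?z = "\<phi> (g [^] n) y"
  have "d y (\<phi> (g [^] Suc n) y) = d y (\<phi> (g [^] n) (\<phi> g y))"
    using assms by (simp add: action_mult)
  also have "\<dots> \<le> d y ?z + d ?z (\<phi> (g [^] n) (\<phi> g y))"
    using assms by (intro triangle action_closed) auto
  also have "d ?z (\<phi> (g [^] n) (\<phi> g y)) = d y (\<phi> g y)"
    using assms by (intro isometric action_closed) auto
  finally show ?case using Suc by (simp add: algebra_simps)
qed

text \<open>Transfers estimates for a shortest conjugate back to \<open>g\<close> itself.\<close>

lemma dist_conjugate_action: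
  assumes "g \<in> carrier G" "h \<in> carrier G" "y \<in> X"
  shows "d (\<phi> h y) (\<phi> (h \<otimes> g \<otimes> inv h) (\<phi> h y)) = d y (\<phi> g y)"
proof -
  interpret group G using group_hom group_hom.axioms by blast
  have "\<phi> (h \<otimes> g \<otimes> inv h) (\<phi> h y) = \<phi> (h \<otimes> g \<otimes> inv h \<otimes> h) y"
    using assms by (simp add: action_mult)
  also have "h \<otimes> g \<otimes> inv h \<otimes> h = h \<otimes> g"
    using assms by (simp add: m_assoc)
  finally show ?thesis
    using assms by (simp add: action_mult isometric action_closed)
qed

text \<open>Moving the base point from \<open>x\<close> to \<open>y\<close> costs at most
  \<open>2 * d x y\<close>, independently of \<open>n\<close>, while
  \<open>d y (\<phi> (g [^] n) y)\<close> grows at most at the rate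
  \<open>d y (\<phi> g y)\<close>.\<close>

lemma growth_rate_le_displacement:
  assumes g: "g \<in> carrier G" and x: "x \<in> X" and y: "y \<in> X"
    and growth: "\<And>n::nat. real n * a - B \<le> d x (\<phi> (g [^] n) x)"
  shows "a \<le> d y (\<phi> g y)"
proof (rule le_if_nat_multiples_le_add)
  interpret group G using group_hom group_hom.axioms by blast
  fix n :: nat
  let ?f = "\<phi> (g [^] n)"
  have fX: "?f x \<in> X" "?f y \<in> X" using g x y by (auto intro: action_closed)
  have "d (?f y) (?f x) = d x y"
    using g x y commute[of x y] by (simp add: isometric)
  with triangle[OF x y fX(1)] triangle[OF y fX(2) fX(1)]
  have "d x (?f x) \<le> 2 * d x y + d y (?f y)" by linarith
  with growth[of n] dist_action_pow_le[OF g y, of n]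
  show "real n * a \<le> real n * d y (\<phi> g y) + (B + 2 * d x y)" by linarith
qed

end

section \<open>Comparison of displacement with translation length\<close>

theorem corollary3p0p3:
  fixes G :: "('a, 'm) monoid_scheme"
    and S :: "'a set"
    and X :: "'b set"
    and d :: "'b \<Rightarrow> 'b \<Rightarrow> real"
    and \<phi> :: "'a \<Rightarrow> 'b \<Rightarrow> 'b"
  assumes "hyperbolic_group G"
    and "finite_generating_set G S"
    and "isometric_action G X d \<phi>"
    and "\<forall>x\<in>X. quasi_isometric_embedding (carrier G) (word_metric G S) X d (\<lambda>g. \<phi> g x)"
  shows "well_displacing G S X d \<phi>"
proof (cases "X = {}")
  case True
  \<comment> \<open>The infimum over the empty set is \<open>\<infinity>\<close>, so the constants 1
    and 1 serve.\<close>
  then show ?thesis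
    by (auto simp: well_displacing_def displacement_def top_ereal_def intro!: exI[of _ 1])
next
  case False
  then obtain x where x: "x \<in> X" by blast
  interpret isometric_action G X d \<phi> by fact
  obtain T where "group G" and T: "finite_generating_set G T"
    and hyp_T: "gromov_hyperbolic (carrier G) (word_metric G T)"
    using \<open>hyperbolic_group G\<close> by (auto simp: hyperbolic_group_def)
  interpret S: finitely_generated_group G S
    using \<open>group G\<close> assms(2)
    by (simp add: finitely_generated_group_def finitely_generated_group_axioms_def)
  interpret T: finitely_generated_group G T
    using \<open>group G\<close> T
    by (simp add: finitely_generated_group_def finitely_generated_group_axioms_def)
  obtain \<delta> where "\<delta> \<ge> 0" and hyp: "\<And>u v w z.
      \<lbrakk>u \<in> carrier G; v \<in> carrier G; w \<in> carrier G; z \<in> carrier G\<rbrakk> \<Longrightarrow>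
      gromov_product (word_metric G T) u v z \<ge>
        min (gromov_product (word_metric G T) u v w) (gromov_product (word_metric G T) u w z) - \<delta>"
    using hyp_T unfolding gromov_hyperbolic_def by meson
  obtain K where "K > 0"
    and K: "\<And>g. g \<in> carrier G \<Longrightarrow> word_length G S g \<le> K * word_length G T g"
    using word_length_Lipschitz[OF S.finitely_generated_group_axioms T.finitely_generated_group_axioms]
    by blast
  obtain K' where "K' > 0"
    and K': "\<And>g. g \<in> carrier G \<Longrightarrow> word_length G T g \<le> K' * word_length G S g"
    using word_length_Lipschitz[OF T.finitely_generated_group_axioms S.finitely_generated_group_axioms]
    by blast
  obtain A B where "A \<ge> 1" and qi: "\<And>g h. \<lbrakk>g \<in> carrier G; h \<in> carrier G\<rbrakk> \<Longrightarrow>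
      inverse A * word_metric G S g h - B \<le> d (\<phi> g x) (\<phi> h x)"
    using assms(4) x unfolding quasi_isometric_embedding_def by blast
  define C where "C = 6 * \<delta> + 2"
  have "C > 0" using \<open>\<delta> \<ge> 0\<close> by (simp add: C_def)
  \<comment> \<open>The factors come from the lower bound on the orbit map (\<open>A\<close>), from
    passing from \<open>T\<close> to \<open>S\<close> for the powers (\<open>K'\<close>), and from
    \<open>S\<close> to \<open>T\<close> for the conjugate (\<open>K\<close>).\<close>
  have bound: "1 / (A * K' * K) * translation_length G S g - C / (A * K') \<le> d y (\<phi> g y)"
    if g: "g \<in> carrier G" and y: "y \<in> X" for g y
  proof -
    \<comment> \<open>The conjugate is shortest with respect to \<open>T\<close>, the generating set
      whose word metric is known to be hyperbolic.\<close>
    obtain h where h: "h \<in> carrier G" and shortest: "\<And>k. k \<in> carrier G \<Longrightarrow>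
        word_length G T (h \<otimes>\<^bsub>G\<^esub> g \<otimes>\<^bsub>G\<^esub> inv\<^bsub>G\<^esub> h)
        \<le> word_length G T (inv\<^bsub>G\<^esub> k \<otimes>\<^bsub>G\<^esub> (h \<otimes>\<^bsub>G\<^esub> g \<otimes>\<^bsub>G\<^esub> inv\<^bsub>G\<^esub> h) \<otimes>\<^bsub>G\<^esub> k)"
      using T.ex_shortest_conjugate[OF g] by metis
    define g' where "g' = h \<otimes>\<^bsub>G\<^esub> g \<otimes>\<^bsub>G\<^esub> inv\<^bsub>G\<^esub> h"
    have g': "g' \<in> carrier G" using g h by (simp add: g'_def)
    define L where "L = real (word_length G T g')"
    have "real n * ((L - C) / (A * K')) - B \<le> d x (\<phi> (g' [^]\<^bsub>G\<^esub> n) x)" for n :: nat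
    proof -
      have "real n * (L - C) \<le> word_length G T (g' [^]\<^bsub>G\<^esub> n)"
        unfolding L_def C_def using hyp g' shortest
        by (intro T.shortest_conjugate_pow_length) (auto simp: g'_def)
      also have "\<dots> \<le> real K' * real (word_length G S (g' [^]\<^bsub>G\<^esub> n))"
        using K'[of "g' [^]\<^bsub>G\<^esub> n"] g' by (metis S.nat_pow_closed of_nat_le_iff of_nat_mult)
      finally have "real n * (L - C) / (A * K')
          \<le> real K' * real (word_length G S (g' [^]\<^bsub>G\<^esub> n)) / (A * K')"
        using \<open>A \<ge> 1\<close> by (intro divide_right_mono) auto
      also have "\<dots> = inverse A * real (word_length G S (g' [^]\<^bsub>G\<^esub> n))"
        using \<open>A \<ge> 1\<close> \<open>K' > 0\<close> by (simp add: field_simps)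
      \<comment> \<open>The orbit map is compared at \<open>\<one>\<close> and the power of
        \<open>g'\<close>, and \<open>\<one>\<close> fixes \<open>x\<close>.\<close>
      also have "\<dots> \<le> d x (\<phi> (g' [^]\<^bsub>G\<^esub> n) x) + B"
        using qi[of "\<one>\<^bsub>G\<^esub>" "g' [^]\<^bsub>G\<^esub> n"] g' x
        by (simp add: action_one S.word_metric_one_left)
      finally show ?thesis by simp
    qed
    \<comment> \<open>The point \<open>\<phi> h y\<close> is chosen because \<open>g'\<close> moves
      it exactly as far as \<open>g\<close> moves \<open>y\<close>.\<close>
    then have "(L - C) / (A * K') \<le> d (\<phi> h y) (\<phi> g' (\<phi> h y))"
      using g' x action_closed[OF h y] by (rule_tac growth_rate_le_displacement)
    also have "\<dots> = d y (\<phi> g y)"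
      unfolding g'_def by (rule dist_conjugate_action[OF g h y])
    finally have *: "(L - C) / (A * K') \<le> d y (\<phi> g y)" .
    have "translation_length G S g \<le> word_length G S g'"
      unfolding g'_def by (rule S.translation_length_le[OF h])
    also have "\<dots> \<le> real K * L"
      using K[OF g'] by (metis L_def of_nat_le_iff of_nat_mult)
    finally have "1 / (A * K' * K) * translation_length G S g \<le> L / (A * K')"
      using \<open>A \<ge> 1\<close> \<open>K > 0\<close> \<open>K' > 0\<close> by (simp add: field_simps)
    with * show ?thesis by (simp add: diff_divide_distrib)
  qed
  show ?thesis
    unfolding well_displacing_def displacement_def
    using bound \<open>A \<ge> 1\<close> \<open>K > 0\<close> \<open>K' > 0\<close> \<open>C > 0\<close>
    by (intro exI[of _ "1 / (A * K' * K)"] exI[of _ "C / (A * K')"] conjI ballI INF_greatest) auto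
qed

end
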